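(* Let $X_1,\dots,X_n$ be i.i.d. real random variables with probability density $f$ and characteristic function $\varphi$, and let $f_n(x;h)$ be the sinc estimator of $f$. Let $\rho>0$ and $0<\alpha\le2$, and suppose that $$\frac{1}{2\pi}\int_{-\infty}^{\infty} e^{\rho|t|^\alpha}|\varphi(t)|^2\,dt=C<\infty .$$ Then there is a function $\varepsilon(h)$ of $h>0$ (not depending on $n$) with $0<\varepsilon(h)<1$ and $\varepsilon(h)\to0$ as $h\to0$ such that, for all $n\ge1$ and $h>0$, $$\mathrm{MISE}(f_n(x;h))\le\varepsilon(h)\,C e^{-\rho/h^\alpha}+\frac{1}{\pi nh}.$$
   Context: The characteristic function is $\varphi(t)=\mathrm{E}\,e^{itX_j}$. The sinc estimator with bandwidth $h>0$ is $f_n(x;h)=\frac{1}{\pi n}\sum_{j=1}^n\frac{\sin[(x-X_j)/h]}{x-X_j}$. $\mathrm{MISE}(f_n(x;h))=\mathrm{E}\int_{-\infty}^{\infty}[f_n(x;h)-f(x)]^2\,dx$. *)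

theory Defs
  imports "HOL-Probability.Probability"
begin

text \<open>Without the case distinction the summand at \<open>x = X\<^sub>j\<close> would be 0 by the convention
  \<open>a / 0 = 0\<close>; \<open>1 / h\<close> is the value of the continuous extension.\<close>

definition sinc_estimator :: "(nat \<Rightarrow> 'a \<Rightarrow> real) \<Rightarrow> nat \<Rightarrow> real \<Rightarrow> 'a \<Rightarrow> real \<Rightarrow> real" where
  "sinc_estimator X n h \<omega> x =
     1 / (pi * real n) *
       (\<Sum>j=1..n. if x = X j \<omega> then 1 / h else sin ((x - X j \<omega>) / h) / (x - X j \<omega>))"

text \<open>The integrals take values in \<open>[0, \<infinity>]\<close>, so that an upper bound on the MISE includes its
  finiteness; a Bochner integral would be 0 in the divergent case.\<close>

definition MISE :: "'a measure \<Rightarrow> ('a \<Rightarrow> real \<Rightarrow> real) \<Rightarrow> (real \<Rightarrow> real) \<Rightarrow> ennreal" where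
  "MISE M g f = (\<integral>\<^sup>+\<omega>. (\<integral>\<^sup>+x. ennreal ((g \<omega> x - f x)\<^sup>2) \<partial>lborel) \<partial>M)"

definition prob_density :: "(real \<Rightarrow> real) \<Rightarrow> bool" where
  "prob_density f \<longleftrightarrow>
     f \<in> borel_measurable borel \<and> (\<forall>x. 0 \<le> f x) \<and> (\<integral>\<^sup>+x. ennreal (f x) \<partial>lborel) = 1"

definition iid_sample :: "'a measure \<Rightarrow> (nat \<Rightarrow> 'a \<Rightarrow> real) \<Rightarrow> nat \<Rightarrow> (real \<Rightarrow> real) \<Rightarrow> bool" where
  "iid_sample M X n f \<longleftrightarrow>
     prob_space M \<and>
     prob_space.indep_vars M (\<lambda>_. borel) X {1..n} \<and>
     (\<forall>j\<in>{1..n}. distributed M lborel (X j) (\<lambda>x. ennreal (f x)))"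

text \<open>The characteristic function of the law with density \<open>f\<close> is \<open>E (exp (i t X\<^sub>j))\<close> for every
  member of every sample from \<open>f\<close>.\<close>

lemma char_density_iid_sample:
  assumes "iid_sample M X n f" "j \<in> {1..n}"
  shows "char (density lborel f) t = (CLINT \<omega>|M. iexp (t * X j \<omega>))"
proof -
  have d: "distributed M lborel (X j) (\<lambda>x. ennreal (f x))"
    using assms by (auto simp: iid_sample_def)
  have [measurable]: "X j \<in> borel_measurable M"
    using distributed_measurable[OF d] by simp
  show ?thesis
    unfolding char_def distributed_distr_eq_density[OF d, symmetric]
    by (subst integral_distr[where N = lborel]) auto
qed

end

theory Submission
  imports Defs
begin

text \<open>The proof moves the problem to the frequency domain. The sinc kernel is the inverse Fourier
transform of the indicator of the band \<open>\<bar>t\<bar> \<le> 1/h\<close>, so the sinc estimator is the inverse transform of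
the empirical characteristic function \<open>\<phi>\<^sub>n\<close> cut off to this band (\<open>sinc_estimator_eq_ft\<close>). The weight
\<open>exp (\<rho> \<bar>t\<bar> powr \<alpha>)\<close> forces \<open>\<phi>\<close> to be integrable (\<open>integrable_of_weighted_sq\<close>), so \<open>f\<close> is almost
everywhere the inverse transform of \<open>\<phi>\<close> (\<open>density_eq_inverse_ft\<close>). Hence the error \<open>f\<^sub>n - f\<close> is the inverse
transform of a function that is \<open>\<phi>\<^sub>n - \<phi>\<close> in the band and \<open>- \<phi>\<close> outside it, and Plancherel's inequality
(\<open>plancherel_le\<close>) together with Tonelli's theorem bounds the MISE by
\<open>1/(2\<pi>)\<close> times the sum of the integral of \<open>E \<bar>\<phi>\<^sub>n - \<phi>\<bar>\<^sup>2\<close> over the band and the integral of \<open>\<bar>\<phi>\<bar>\<^sup>2\<close> over its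
complement (\<open>MISE_sinc_le\<close>).

The first part is the variance. Since \<open>\<phi>\<^sub>n\<close> is a mean of \<open>n\<close> independent variables of modulus 1, the
mean square error is at most \<open>1/n\<close> (\<open>emp_char_mean_sq_error_le\<close>), and the band has length \<open>2/h\<close>; this
gives \<open>1/(\<pi> n h)\<close>. The second part is the squared bias. Outside the band the weight is at least
\<open>exp (\<rho> / h powr \<alpha>)\<close>, so this part is at most \<open>exp (- \<rho> / h powr \<alpha>) C r(h)\<close>, where \<open>r(h)\<close> is the fraction of
the weighted integral that lies outside the band. The fraction tends to 0 by dominated convergence
and is less than 1 because \<open>\<phi>\<close> is continuous with \<open>\<phi>(0) = 1\<close>. It can be 0, for small \<open>h\<close>
when \<open>\<phi>\<close> has compact support, and \<open>\<epsilon>(h) = (r(h) + h) / (1 + h)\<close> is a strictly positive majorant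
that keeps the other two properties.\<close>

section \<open>Fourier integrals of integrable functions\<close>

text \<open>The sign and the missing factor \<open>1/(2\<pi>)\<close> are those of the inversion formula: \<open>ft \<phi> / (2\<pi>)\<close> is
  the density with characteristic function \<open>\<phi>\<close> when \<open>\<phi>\<close> is integrable.\<close>

definition ft :: "(real \<Rightarrow> complex) \<Rightarrow> real \<Rightarrow> complex" where
  "ft g x = (CLBINT t. g t * iexp (- (t * x)))"

lemma borel_measurable_ft [measurable]:
  assumes [measurable]: "g \<in> borel_measurable borel"
  shows "ft g \<in> borel_measurable borel"
  unfolding ft_def by measurable

lemma integrable_times_iexp:
  assumes "integrable lborel g"
  shows "complex_integrable lborel (\<lambda>t. g t * iexp (- (t * x)))"
proof (rule Bochner_Integration.integrable_bound[OF assms])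
  have [measurable]: "g \<in> borel_measurable borel" using borel_measurable_integrable[OF assms] by simp
  show "(\<lambda>t. g t * iexp (- (t * x))) \<in> borel_measurable lborel" by measurable
qed (simp add: norm_mult)

lemma cmod_ft_le:
  assumes "integrable lborel g"
  shows "cmod (ft g x) \<le> (LBINT t. cmod (g t))"
proof -
  have "cmod (ft g x) \<le> (LBINT t. cmod (g t * iexp (- (t * x))))"
    unfolding ft_def by (rule integral_norm_bound)
  then show ?thesis by (simp add: norm_mult)
qed

lemma borel_measurable_cnj [measurable]: "cnj \<in> borel_measurable borel"
  by (intro borel_measurable_continuous_onI continuous_intros)

lemma integrable_pair_times:
  fixes g k :: "real \<Rightarrow> complex"
  assumes g: "integrable lborel g" and k: "integrable lborel k"
  shows "integrable (lborel \<Otimes>\<^sub>M lborel) (\<lambda>p. g (fst p) * k (snd p))"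
proof (rule lborel_pair.Fubini_integrable)
  have [measurable]: "g \<in> borel_measurable borel" "k \<in> borel_measurable borel"
    using borel_measurable_integrable[OF g] borel_measurable_integrable[OF k] by simp_all
  show "(\<lambda>p. g (fst p) * k (snd p)) \<in> borel_measurable (lborel \<Otimes>\<^sub>M lborel)" by measurable
  show "integrable lborel (\<lambda>x. LBINT y. cmod (g (fst (x, y)) * k (snd (x, y))))"
    using g by (simp add: norm_mult)
  show "AE x in lborel. complex_integrable lborel (\<lambda>y. g (fst (x, y)) * k (snd (x, y)))"
    using k by simp
qed

text \<open>Expanding \<open>\<bar>ft g x\<bar>\<^sup>2\<close> as a double integral of \<open>g u * cnj (g v) * iexp (x * (v - u))\<close> and integrating
  over \<open>x\<close> first turns the exponential into the characteristic function of \<open>N\<close>. That \<open>N\<close> is finite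
  makes the triple integral absolutely convergent.\<close>

lemma nn_integral_ft_sq_le_char:
  assumes N: "real_distribution N" and g: "integrable lborel g"
  shows "(\<integral>\<^sup>+x. ennreal ((cmod (ft g x))\<^sup>2) \<partial>N)
    \<le> (\<integral>\<^sup>+u. (\<integral>\<^sup>+v. ennreal (cmod (g u) * cmod (g v) * cmod (char N (v - u))) \<partial>lborel) \<partial>lborel)"
proof -
  interpret N: real_distribution N by fact
  interpret P: pair_sigma_finite N "lborel \<Otimes>\<^sub>M lborel :: (real \<times> real) measure"
    by (intro pair_sigma_finite.intro N.sigma_finite_measure_axioms lborel_pair.sigma_finite_measure_axioms) 
  have [measurable_cong]: "sets N = sets borel" by simp
  have gm [measurable]: "g \<in> borel_measurable borel" using borel_measurable_integrable[OF g] by simp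
  define F :: "real \<Rightarrow> real \<times> real \<Rightarrow> complex"
    where "F x p = g (fst p) * cnj (g (snd p)) * iexp (x * (snd p - fst p))" for x p
  have Fm: "(\<lambda>q. F (fst q) (snd q)) \<in> borel_measurable (N \<Otimes>\<^sub>M (lborel \<Otimes>\<^sub>M lborel))"
    unfolding F_def by measurable
  have gc: "integrable lborel (\<lambda>t. cnj (g t))" using g by simp
  have G2: "integrable (lborel \<Otimes>\<^sub>M lborel) (\<lambda>p. g (fst p) * cnj (g (snd p)))"
    by (rule integrable_pair_times[OF g gc])
  have [measurable]: "F x \<in> borel_measurable (lborel \<Otimes>\<^sub>M lborel)" for x
    unfolding F_def by measurable
  have Fx: "integrable (lborel \<Otimes>\<^sub>M lborel) (F x)" for x
    by (rule Bochner_Integration.integrable_bound[OF G2]) (auto simp: F_def norm_mult)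
  have FI: "integrable (N \<Otimes>\<^sub>M (lborel \<Otimes>\<^sub>M lborel)) (\<lambda>q. F (fst q) (snd q))"
  proof (rule P.Fubini_integrable[OF Fm])
    show "integrable N (\<lambda>x. \<integral>y. cmod (F (fst (x, y)) (snd (x, y))) \<partial>(lborel \<Otimes>\<^sub>M lborel))"
      by (simp add: F_def norm_mult)
  qed (simp add: Fx)
  have sq: "complex_of_real ((cmod (ft g x))\<^sup>2) = (\<integral>p. F x p \<partial>(lborel \<Otimes>\<^sub>M lborel))" for x
  proof -
    have 1: "F x (u, v) = (g u * iexp (- (u * x))) * cnj (g v * iexp (- (v * x)))" for u v
      by (simp add: F_def exp_cnj exp_diff exp_minus field_simps)
    have "(\<integral>p. F x p \<partial>(lborel \<Otimes>\<^sub>M lborel)) = (CLBINT u. CLBINT v. F x (u, v))"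
      by (rule lborel_pair.integral_fst'[OF Fx, symmetric])
    also have "\<dots> = (CLBINT u. (g u * iexp (- (u * x))) * cnj (ft g x))"
      unfolding 1 ft_def Bochner_Integration.integral_mult_right_zero by (simp only: Bochner_Integration.integral_cnj)
    also have "\<dots> = ft g x * cnj (ft g x)"
      unfolding ft_def by (subst Bochner_Integration.integral_mult_left_zero) simp
    finally show ?thesis by (simp only: complex_norm_square)
  qed
  have i2: "integrable N (\<lambda>x. (cmod (ft g x))\<^sup>2)"
    using cmod_ft_le[OF g]
    by (intro N.integrable_const_bound[where B="(LBINT t. cmod (g t))\<^sup>2"])
       (auto intro!: power_mono borel_measurable_power)
  have "complex_of_real (\<integral>x. (cmod (ft g x))\<^sup>2 \<partial>N) = (\<integral>x. (\<integral>p. F x p \<partial>(lborel \<Otimes>\<^sub>M lborel)) \<partial>N)"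
    unfolding integral_complex_of_real[symmetric] sq ..
  also have "\<dots> = (\<integral>p. (\<integral>x. F x p \<partial>N) \<partial>(lborel \<Otimes>\<^sub>M lborel))"
    by (rule P.Fubini_integral[symmetric]) (use FI in \<open>simp add: case_prod_beta'\<close>)
  also have "\<dots> = (\<integral>p. g (fst p) * cnj (g (snd p)) * char N (snd p - fst p) \<partial>(lborel \<Otimes>\<^sub>M lborel))"
    unfolding F_def char_def by (simp add: mult.commute[of "_ :: real"])
  finally have eq: "complex_of_real (\<integral>x. (cmod (ft g x))\<^sup>2 \<partial>N) =
    (\<integral>p. g (fst p) * cnj (g (snd p)) * char N (snd p - fst p) \<partial>(lborel \<Otimes>\<^sub>M lborel))" .
  have ci: "integrable (lborel \<Otimes>\<^sub>M lborel) (\<lambda>p. g (fst p) * cnj (g (snd p)) * char N (snd p - fst p))"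
    by (rule Bochner_Integration.integrable_bound[OF G2])
       (auto simp: norm_mult intro!: mult_left_le N.cmod_char_le_1)
  have "(\<integral>\<^sup>+x. ennreal ((cmod (ft g x))\<^sup>2) \<partial>N) = ennreal (\<integral>x. (cmod (ft g x))\<^sup>2 \<partial>N)"
    by (rule nn_integral_eq_integral[OF i2]) simp
  also have "\<dots> = ennreal (cmod (\<integral>p. g (fst p) * cnj (g (snd p)) * char N (snd p - fst p) \<partial>(lborel \<Otimes>\<^sub>M lborel)))"
    unfolding eq[symmetric] by simp
  also have "\<dots> \<le> (\<integral>\<^sup>+p. cmod (g (fst p) * cnj (g (snd p)) * char N (snd p - fst p)) \<partial>(lborel \<Otimes>\<^sub>M lborel))"
    by (rule integral_norm_bound_ennreal[OF ci])
  also have "\<dots> = (\<integral>\<^sup>+u. (\<integral>\<^sup>+v. ennreal (cmod (g u) * cmod (g v) * cmod (char N (v - u))) \<partial>lborel) \<partial>lborel)"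
    by (subst lborel.nn_integral_fst[symmetric]) (auto simp: norm_mult)
  finally show ?thesis .
qed

section \<open>The inequality half of Plancherel's theorem\<close>

lemma nn_integral_std_normal_density: "(\<integral>\<^sup>+x. ennreal (std_normal_density x) \<partial>lborel) = 1"
  by (subst nn_integral_eq_integral) auto

lemma gaussian_kernel_nn_integral:
  assumes "0 < s"
  shows "(\<integral>\<^sup>+v. ennreal (exp (- ((s * (v - u))\<^sup>2) / 2)) \<partial>lborel) = ennreal (sqrt (2 * pi) / s)"
proof -
  have "ennreal (sqrt (2 * pi)) = (\<integral>\<^sup>+x. ennreal (sqrt (2 * pi)) * ennreal (std_normal_density x) \<partial>lborel)"
    by (simp add: nn_integral_cmult nn_integral_std_normal_density)
  also have "\<dots> = (\<integral>\<^sup>+x. ennreal (exp (- x\<^sup>2 / 2)) \<partial>lborel)"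
    by (intro nn_integral_cong) (simp add: std_normal_density_def flip: ennreal_mult)
  also have "\<dots> = ennreal s * (\<integral>\<^sup>+v. ennreal (exp (- ((- s * u + s * v)\<^sup>2) / 2)) \<partial>lborel)"
    using assms by (subst nn_integral_real_affine[where c = s and t = "- s * u"]) auto
  also have "(\<lambda>v. - s * u + s * v) = (\<lambda>v. s * (v - u))"
    by (simp add: algebra_simps)
  finally have "ennreal (sqrt (2 * pi)) = ennreal s * (\<integral>\<^sup>+v. ennreal (exp (- ((s * (v - u))\<^sup>2) / 2)) \<partial>lborel)"
    by (simp add: algebra_simps)
  then have "ennreal (1 / s) * ennreal (sqrt (2 * pi)) =
    ennreal (1 / s) * ennreal s * (\<integral>\<^sup>+v. ennreal (exp (- ((s * (v - u))\<^sup>2) / 2)) \<partial>lborel)"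
    by (simp add: mult.assoc)
  then show ?thesis using assms by (simp flip: ennreal_mult)
qed

text \<open>Applied to the normal law of standard deviation \<open>s\<close>, the previous bound contains the kernel
  \<open>exp (- (s * (v - u))\<^sup>2 / 2)\<close>. By \<open>2 \<bar>g u\<bar> \<bar>g v\<bar> \<le> \<bar>g u\<bar>\<^sup>2 + \<bar>g v\<bar>\<^sup>2\<close> and symmetry, only the mass
  \<open>sqrt (2\<pi>) / s\<close> of the kernel enters; the normalisation \<open>sqrt (2\<pi>) * s\<close> of the normal density cancels its
  dependence on \<open>s\<close>.\<close>

lemma gaussian_plancherel_le:
  assumes g: "integrable lborel g" and s: "0 < s"
  shows "(\<integral>\<^sup>+x. ennreal ((cmod (ft g x))\<^sup>2 * exp (- ((x / s)\<^sup>2) / 2)) \<partial>lborel)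
    \<le> ennreal (2 * pi) * (\<integral>\<^sup>+t. ennreal ((cmod (g t))\<^sup>2) \<partial>lborel)"
proof -
  have gm [measurable]: "g \<in> borel_measurable borel" using borel_measurable_integrable[OF g] by simp
  interpret Z: real_distribution std_normal_distribution by (rule real_dist_normal_dist)
  \<comment> \<open>The normal law of standard deviation \<open>s\<close>, obtained by scaling the standard one.\<close>
  define N where "N = distr std_normal_distribution borel (\<lambda>x. s * x)"
  have N: "real_distribution N" unfolding N_def by simp
  have char_N: "char N t = complex_of_real (exp (- ((s * t)\<^sup>2) / 2))" for t
  proof -
    have "char N t = char std_normal_distribution (s * t)"
      unfolding N_def char_def by (subst integral_distr) (auto simp: mult_ac)
    then show ?thesis by (simp add: char_std_normal_distribution)
  qed
  define A where "A = (\<integral>\<^sup>+t. ennreal ((cmod (g t))\<^sup>2) \<partial>lborel)"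
  define k where "k u v = exp (- ((s * (v - u))\<^sup>2) / 2)" for u v :: real
  have [measurable]: "(\<lambda>p. k (fst p) (snd p)) \<in> borel_measurable (borel \<Otimes>\<^sub>M borel)"
    unfolding k_def by measurable
  have k_sym: "k u v = k v u" for u v unfolding k_def by (simp add: power2_commute power_mult_distrib)
  have k_nonneg: "0 \<le> k u v" for u v unfolding k_def by simp
  have half: "(\<integral>\<^sup>+u. (\<integral>\<^sup>+v. ennreal ((cmod (g u))\<^sup>2 * k u v / 2) \<partial>lborel) \<partial>lborel)
      = ennreal (sqrt (2 * pi) / s / 2) * A"
  proof -
    have "(\<integral>\<^sup>+v. ennreal ((cmod (g u))\<^sup>2 * k u v / 2) \<partial>lborel) = 
       ennreal ((cmod (g u))\<^sup>2) * ennreal (sqrt (2 * pi) / s / 2)" for u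
    proof -
      have "(\<integral>\<^sup>+v. ennreal ((cmod (g u))\<^sup>2 * k u v / 2) \<partial>lborel)
        = (\<integral>\<^sup>+v. ennreal ((cmod (g u))\<^sup>2 / 2) * ennreal (exp (- ((s * (v - u))\<^sup>2) / 2)) \<partial>lborel)"
        by (intro nn_integral_cong) (simp add: k_def flip: ennreal_mult)
      also have "\<dots> = ennreal ((cmod (g u))\<^sup>2 / 2) * ennreal (sqrt (2 * pi) / s)"
        by (subst nn_integral_cmult) (auto simp only: gaussian_kernel_nn_integral[OF s], measurable)
      finally show ?thesis using s by (simp flip: ennreal_mult)
    qed
    then show ?thesis unfolding A_def by (simp add: nn_integral_multc mult.commute)
  qed
  have half': "(\<integral>\<^sup>+u. (\<integral>\<^sup>+v. ennreal ((cmod (g v))\<^sup>2 * k u v / 2) \<partial>lborel) \<partial>lborel)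
      = ennreal (sqrt (2 * pi) / s / 2) * A"
  proof -
    have "(\<integral>\<^sup>+u. (\<integral>\<^sup>+v. ennreal ((cmod (g v))\<^sup>2 * k u v / 2) \<partial>lborel) \<partial>lborel)
      = (\<integral>\<^sup>+v. (\<integral>\<^sup>+u. ennreal ((cmod (g v))\<^sup>2 * k u v / 2) \<partial>lborel) \<partial>lborel)"
      by (rule lborel_pair.Fubini'[symmetric]) simp
    then show ?thesis using half by (simp add: k_sym)
  qed
  have amgm: "cmod (g u) * cmod (g v) * k u v \<le> (cmod (g u))\<^sup>2 * k u v / 2 + (cmod (g v))\<^sup>2 * k u v / 2" for u v
  proof -
    have "2 * (cmod (g u) * cmod (g v)) * k u v \<le> ((cmod (g u))\<^sup>2 + (cmod (g v))\<^sup>2) * k u v"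
      using sum_squares_bound[of "cmod (g u)" "cmod (g v)"] by (intro mult_right_mono k_nonneg) simp
    then show ?thesis by (simp add: field_simps)
  qed
  have "(\<integral>\<^sup>+x. ennreal ((cmod (ft g x))\<^sup>2) \<partial>N)
      \<le> (\<integral>\<^sup>+u. (\<integral>\<^sup>+v. ennreal (cmod (g u) * cmod (g v) * k u v) \<partial>lborel) \<partial>lborel)"
    using nn_integral_ft_sq_le_char[OF N g] by (simp add: char_N k_def)
  also have "\<dots> \<le> (\<integral>\<^sup>+u. (\<integral>\<^sup>+v. ennreal ((cmod (g u))\<^sup>2 * k u v / 2) + ennreal ((cmod (g v))\<^sup>2 * k u v / 2) \<partial>lborel) \<partial>lborel)"
    by (intro nn_integral_mono, subst ennreal_plus[symmetric])
       (auto intro!: ennreal_leI amgm mult_nonneg_nonneg k_nonneg)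
  also have "\<dots> = ennreal (sqrt (2 * pi) / s / 2) * A + ennreal (sqrt (2 * pi) / s / 2) * A"
    by (subst half[symmetric], subst half'[symmetric])
       (simp add: nn_integral_add k_def)
  also have "\<dots> = ennreal (sqrt (2 * pi) / s) * A"
    using s by (simp flip: distrib_right ennreal_plus)
  finally have bound: "(\<integral>\<^sup>+x. ennreal ((cmod (ft g x))\<^sup>2) \<partial>N) \<le> ennreal (sqrt (2 * pi) / s) * A" .
  have "(\<integral>\<^sup>+x. ennreal ((cmod (ft g x))\<^sup>2 * exp (- ((x / s)\<^sup>2) / 2)) \<partial>lborel)
    = ennreal s * (\<integral>\<^sup>+x. ennreal ((cmod (ft g (s * x)))\<^sup>2 * exp (- x\<^sup>2 / 2)) \<partial>lborel)"
    using s by (subst nn_integral_real_affine[where c = s and t = 0]) auto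
  also have "\<dots> = ennreal s * (\<integral>\<^sup>+x. ennreal (sqrt (2 * pi)) * (ennreal (std_normal_density x) * ennreal ((cmod (ft g (s * x)))\<^sup>2)) \<partial>lborel)"
    by (intro arg_cong2[where f = "(*)"] refl nn_integral_cong)
       (simp add: std_normal_density_def mult_ac flip: ennreal_mult)
  also have "\<dots> = ennreal s * (ennreal (sqrt (2 * pi)) * (\<integral>\<^sup>+x. ennreal ((cmod (ft g x))\<^sup>2) \<partial>N))"
    unfolding N_def by (simp add: nn_integral_cmult nn_integral_distr nn_integral_density)
  also have "\<dots> \<le> ennreal s * (ennreal (sqrt (2 * pi)) * (ennreal (sqrt (2 * pi) / s) * A))"
    by (intro mult_left_mono bound) auto
  also have "\<dots> = ennreal (s * (sqrt (2 * pi) * (sqrt (2 * pi) / s))) * A"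
  proof -
    have "ennreal (s * (sqrt (2 * pi) * (sqrt (2 * pi) / s))) = ennreal s * (ennreal (sqrt (2 * pi)) * ennreal (sqrt (2 * pi) / s))"
    proof -
      have "0 \<le> s" "0 \<le> sqrt (2 * pi)" "0 \<le> sqrt (2 * pi) / s" "0 \<le> sqrt (2 * pi) * (sqrt (2 * pi) / s)"
        using s by simp_all
      then show ?thesis by (simp only: ennreal_mult)
    qed
    then show ?thesis by (simp only: mult.assoc)
  qed
  also have "s * (sqrt (2 * pi) * (sqrt (2 * pi) / s)) = 2 * pi" using s by simp
  finally show ?thesis unfolding A_def .
qed

text \<open>The Gaussian weights increase to 1 as \<open>s\<close> grows, and the bound does not depend on \<open>s\<close>, so
  Fatou's lemma removes the weight. An upper bound for the error is all that is at stake, so the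
  inequality is enough.\<close>

lemma plancherel_le:
  assumes g: "integrable lborel g"
  shows "(\<integral>\<^sup>+x. ennreal ((cmod (ft g x))\<^sup>2) \<partial>lborel)
    \<le> ennreal (2 * pi) * (\<integral>\<^sup>+t. ennreal ((cmod (g t))\<^sup>2) \<partial>lborel)"
proof -
  have gm [measurable]: "g \<in> borel_measurable borel" using borel_measurable_integrable[OF g] by simp
  define w where "w n x = ennreal ((cmod (ft g x))\<^sup>2 * exp (- ((x / real (Suc n))\<^sup>2) / 2))" for n x
  have lim: "(\<lambda>n. w n x) \<longlonglongrightarrow> ennreal ((cmod (ft g x))\<^sup>2)" for x
  proof -
    have "(\<lambda>n. x * inverse (real (Suc n))) \<longlonglongrightarrow> x * 0"
      by (intro tendsto_intros LIMSEQ_inverse_real_of_nat)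
    then have "(\<lambda>n. x / real (Suc n)) \<longlonglongrightarrow> 0" by (simp add: divide_inverse)
    then have "(\<lambda>n. (cmod (ft g x))\<^sup>2 * exp (- ((x / real (Suc n))\<^sup>2) / 2)) \<longlonglongrightarrow> (cmod (ft g x))\<^sup>2 * exp (- (0\<^sup>2) / 2)"
      by (intro tendsto_intros) auto
    then show ?thesis unfolding w_def by (auto intro!: tendsto_ennrealI)
  qed
  have "(\<integral>\<^sup>+x. ennreal ((cmod (ft g x))\<^sup>2) \<partial>lborel) = (\<integral>\<^sup>+x. liminf (\<lambda>n. w n x) \<partial>lborel)"
    by (intro nn_integral_cong lim_imp_Liminf[symmetric] lim) simp
  also have "\<dots> \<le> liminf (\<lambda>n. \<integral>\<^sup>+x. w n x \<partial>lborel)"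
    by (intro nn_integral_liminf) (simp add: w_def)
  also have "\<dots> \<le> ennreal (2 * pi) * (\<integral>\<^sup>+t. ennreal ((cmod (g t))\<^sup>2) \<partial>lborel)"
    unfolding w_def by (intro Liminf_le always_eventually allI gaussian_plancherel_le[OF g]) auto
  finally show ?thesis .
qed

section \<open>Fourier inversion for densities\<close>

text \<open>Moving negative parts to the other side turns the hypothesis into the agreement of two measures
  with nonnegative densities on half-open intervals. These generate the Borel sets, so the measures
  are equal, and then so are their densities.\<close>

lemma AE_eq_if_Ioc_integrals_eq:
  fixes f r :: "real \<Rightarrow> real"
  assumes fi: "\<And>a b. a \<le> b \<Longrightarrow> set_integrable lborel {a<..b} f"
    and ri: "\<And>a b. a \<le> b \<Longrightarrow> set_integrable lborel {a<..b} r"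
    and fm [measurable]: "f \<in> borel_measurable borel" and rm [measurable]: "r \<in> borel_measurable borel"
    and eq: "\<And>a b. a \<le> b \<Longrightarrow> (LBINT x:{a<..b}. f x) = (LBINT x:{a<..b}. r x)"
  shows "AE x in lborel. f x = r x"
proof -
  \<comment> \<open>Two nonnegative functions with \<open>p - q = f - r\<close>, built from positive and negative parts.\<close>
  define p where "p x = max 0 (f x) + max 0 (- r x)" for x
  define q where "q x = max 0 (r x) + max 0 (- f x)" for x
  have [measurable]: "p \<in> borel_measurable borel" "q \<in> borel_measurable borel"
    unfolding p_def q_def by measurable
  have pq: "p x - q x = f x - r x" "0 \<le> p x" "0 \<le> q x" for x unfolding p_def q_def by auto
  have pi: "set_integrable lborel {a<..b} p" if "a \<le> b" for a b
    unfolding set_integrable_def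
    by (rule Bochner_Integration.integrable_bound[OF Bochner_Integration.integrable_add[OF
        integrable_abs[OF fi[OF that, unfolded set_integrable_def]] integrable_abs[OF ri[OF that, unfolded set_integrable_def]]]])
       (auto simp: p_def indicator_def)
  have qi: "set_integrable lborel {a<..b} q" if "a \<le> b" for a b
    unfolding set_integrable_def
    by (rule Bochner_Integration.integrable_bound[OF Bochner_Integration.integrable_add[OF
        integrable_abs[OF fi[OF that, unfolded set_integrable_def]] integrable_abs[OF ri[OF that, unfolded set_integrable_def]]]])
       (auto simp: q_def indicator_def)
  have em: "emeasure (density lborel (\<lambda>x. ennreal (k x))) {a<..b} = ennreal (LBINT x:{a<..b}. k x)"
    if "set_integrable lborel {a<..b} k" "\<And>x. 0 \<le> k x" "k \<in> borel_measurable borel"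
    for k :: "real \<Rightarrow> real" and a b
  proof -
    note [measurable] = that(3)
    have "emeasure (density lborel (\<lambda>x. ennreal (k x))) {a<..b} = (\<integral>\<^sup>+x. ennreal (indicator {a<..b} x *\<^sub>R k x) \<partial>lborel)"
      by (subst emeasure_density) (auto intro!: nn_integral_cong simp: indicator_def)
    then show ?thesis
      using that(1,2) unfolding set_lebesgue_integral_def set_integrable_def
      by (simp add: nn_integral_eq_integral)
  qed
  have emeq: "emeasure (density lborel (\<lambda>x. ennreal (p x))) {a<..b} = emeasure (density lborel (\<lambda>x. ennreal (q x))) {a<..b}"
    if "a \<le> b" for a b
  proof -
    have "(LBINT x:{a<..b}. p x) - (LBINT x:{a<..b}. q x) = (LBINT x:{a<..b}. p x - q x)"
      by (simp add: set_integral_diff pi[OF that] qi[OF that])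
    also have "\<dots> = (LBINT x:{a<..b}. f x) - (LBINT x:{a<..b}. r x)"
      unfolding pq by (simp add: set_integral_diff fi[OF that] ri[OF that])
    finally show ?thesis using eq[OF that] by (simp add: em pi[OF that] qi[OF that] pq)
  qed
  have "density lborel (\<lambda>x. ennreal (p x)) = density lborel (\<lambda>x. ennreal (q x))"
  proof (rule measure_eqI_generator_eq[where \<Omega>=UNIV and E="range (\<lambda>(a, b). {a<..b::real})" and A="\<lambda>n. {- real n<..real n}"])
    show "Int_stable (range (\<lambda>(a, b). {a<..b::real}))"
      by (auto simp: Int_stable_def)
    show "emeasure (density lborel (\<lambda>x. ennreal (p x))) X = emeasure (density lborel (\<lambda>x. ennreal (q x))) X"
      if X: "X \<in> range (\<lambda>(a, b). {a<..b::real})" for X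
    proof -
      obtain a b where [simp]: "X = {a<..b}" using X by auto
      show ?thesis by (cases "a \<le> b") (auto simp: emeq)
    qed
    show "sets (density lborel (\<lambda>x. ennreal (p x))) = sigma_sets UNIV (range (\<lambda>(a, b). {a<..b}))"
      "sets (density lborel (\<lambda>x. ennreal (q x))) = sigma_sets UNIV (range (\<lambda>(a, b). {a<..b}))"
      by (simp_all add: borel_sigma_sets_Ioc)
    show "(\<Union>n. {- real n<..real n}) = UNIV"
    proof safe
      fix x :: real
      obtain n where "\<bar>x\<bar> < real n" using reals_Archimedean2 by blast
      then show "x \<in> (\<Union>n. {- real n<..real n})" by (auto intro!: exI[of _ n])
    qed auto
    show "emeasure (density lborel (\<lambda>x. ennreal (p x))) {- real n<..real n} \<noteq> \<infinity>" for n
      by (simp add: em pi pq)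
  qed auto
  then have "AE x in lborel. ennreal (p x) = ennreal (q x)"
    by (intro sigma_finite_measure.density_unique[OF lborel.sigma_finite_measure_axioms]) auto
  then show ?thesis
  proof eventually_elim
    case (elim x)
    then have "p x = q x" using pq by simp
    then show ?case using pq(1)[of x] by simp
  qed
qed

lemma CLBINT_Ioc_iexp:
  assumes "a \<le> b" "t \<noteq> 0"
  shows "(CLBINT x:{a<..b}. iexp (- (t * x))) = (iexp (- (t * a)) - iexp (- (t * b))) / (\<i> * t)"
proof -
  have "(CLBINT x:{a<..b}. iexp (- (t * x))) = (CLBINT x=a..b. iexp (- (t * x)))"
    using assms by (simp add: interval_integral_Ioc)
  also have "\<dots> = (- iexp (- (t * b)) / (\<i> * t)) - (- iexp (- (t * a)) / (\<i> * t))"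
  proof (rule interval_integral_FTC_finite)
    show "continuous_on {min a b..max a b} (\<lambda>x. iexp (- (t * x)))"
      by (intro continuous_intros)
    fix x
    have D: "((\<lambda>z. - exp (\<i> * - (of_real t * z)) / (\<i> * t)) has_field_derivative iexp (- (t * x))) (at (of_real x))"
      using assms(2) by (auto intro!: derivative_eq_intros simp: mult.left_commute[of \<i> "exp _"])
    show "((\<lambda>x. - iexp (- (t * x)) / (\<i> * t)) has_vector_derivative iexp (- (t * x))) (at x within {min a b..max a b})"
      using has_vector_derivative_real_field[OF D] by simp
  qed
  also have "\<dots> = (iexp (- (t * a)) - iexp (- (t * b))) / (\<i> * t)"
    by (simp add: diff_divide_distrib)
  finally show ?thesis .
qed

text \<open>For an integrable characteristic function the limit in \<open>Levy_Inversion\<close> is an integral over the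
  whole line, by dominated convergence. Its kernel is itself the integral of \<open>iexp (- (t * x))\<close> over
  \<open>{a<..b}\<close>, and Fubini's theorem exchanges the two integrations.\<close>

lemma (in real_distribution) Levy_inversion_integrable_char:
  assumes ab: "a \<le> b" and atom: "measure M {a} = 0" "measure M {b} = 0"
    and \<phi>: "integrable lborel (char M)"
  shows "measure M {a<..b} = (LBINT x:{a<..b}. Re (ft (char M) x) / (2 * pi))"
proof -
  \<comment> \<open>At \<open>t = 0\<close> the quotient is 0 by convention, which is harmless under the integral.\<close>
  define H where "H t = (iexp (- (t * a)) - iexp (- (t * b))) / (\<i> * t) * char M t" for t
  have [measurable]: "H \<in> borel_measurable borel" unfolding H_def by measurable
  have Hbound: "cmod (H t) \<le> (b - a) * cmod (char M t)" for t
  proof (cases "t = 0")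
    case True then show ?thesis using ab by (simp add: H_def)
  next
    case False
    have "cmod ((iexp (- (t * a)) - iexp (- (t * b))) / (\<i> * t)) \<le> b - a"
      using Levy_Inversion_aux2[of "- b" "- a" t] ab False by simp
    then show ?thesis unfolding H_def norm_mult by (rule mult_right_mono) simp
  qed
  have wi: "integrable lborel (\<lambda>t. (b - a) * cmod (char M t))" using \<phi> by simp
  have HI: "integrable lborel H"
    by (rule Bochner_Integration.integrable_bound[OF wi]) (use Hbound in \<open>auto intro: order_trans[OF _ abs_ge_self]\<close>)
  have "(\<lambda>n::nat. CLBINT t. indicator {- real n<..<real n} t *\<^sub>R H t) \<longlonglongrightarrow> (CLBINT t. H t)"
  proof (rule integral_dominated_convergence[OF _ _ wi])
    show "AE t in lborel. (\<lambda>n::nat. indicator {- real n<..<real n} t *\<^sub>R H t) \<longlonglongrightarrow> H t"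
    proof (rule AE_I2)
      fix t :: real
      obtain n0 where n0: "\<bar>t\<bar> < real n0" using reals_Archimedean2 by blast
      have "eventually (\<lambda>n. indicator {- real n<..<real n} t *\<^sub>R H t = H t) sequentially"
        using eventually_ge_at_top[of n0] by eventually_elim (use n0 in \<open>auto simp: indicator_def\<close>)
      then show "(\<lambda>n::nat. indicator {- real n<..<real n} t *\<^sub>R H t) \<longlonglongrightarrow> H t"
        by (rule tendsto_eventually)
    qed
    show "AE t in lborel. cmod (indicator {- real n<..<real n} t *\<^sub>R H t) \<le> (b - a) * cmod (char M t)" for n :: nat
      using Hbound ab by (auto simp: indicator_def)
  qed auto
  then have "(\<lambda>n::nat. 1 / (2 * pi) * (CLBINT t=- real n..real n. H t)) \<longlonglongrightarrow> 1 / (2 * pi) * (CLBINT t. H t)"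
    by (intro tendsto_intros) (simp add: interval_lebesgue_integral_def set_lebesgue_integral_def)
  moreover have "(\<lambda>n::nat. 1 / (2 * pi) * (CLBINT t=- real n..real n. H t)) \<longlonglongrightarrow> complex_of_real (measure M {a<..b})"
    unfolding H_def using Levy_Inversion[OF ab atom] by simp
  ultimately have L: "complex_of_real (measure M {a<..b}) = 1 / (2 * pi) * (CLBINT t. H t)"
    by (rule LIMSEQ_unique[rotated])
  define K where "K p = (indicator {a<..b} (snd p) * iexp (- (fst p * snd p))) * char M (fst p)" for p :: "real \<times> real"
  have KI: "integrable (lborel \<Otimes>\<^sub>M lborel) K"
  proof (rule Bochner_Integration.integrable_bound)
    have "integrable lborel (\<lambda>x. indicator {a<..b} x *\<^sub>R (1 :: complex))"
      by (intro integrableI_bounded_set_indicator[where B = 1]) (use ab in auto)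
    from integrable_pair_times[OF \<phi> this]
    show "integrable (lborel \<Otimes>\<^sub>M lborel) (\<lambda>p. char M (fst p) * (indicator {a<..b} (snd p) *\<^sub>R 1))" .
    show "K \<in> borel_measurable (lborel \<Otimes>\<^sub>M lborel)" unfolding K_def by measurable
  qed (auto simp: K_def norm_mult indicator_def)
  have "(CLBINT t. H t) = (CLBINT t. CLBINT x. K (t, x))"
  proof (rule integral_cong_AE)
    have "AE t in lborel. t \<noteq> (0::real)" by (rule AE_lborel_singleton)
    then show "AE t in lborel. H t = (CLBINT x. K (t, x))"
    proof eventually_elim
      case (elim t)
      have "(CLBINT x. K (t, x)) = (CLBINT x. (indicator {a<..b} x *\<^sub>R iexp (- (t * x))) * char M t)"
        by (rule Bochner_Integration.integral_cong[OF refl]) (simp add: K_def indicator_def)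
      also have "\<dots> = (CLBINT x:{a<..b}. iexp (- (t * x))) * char M t"
        unfolding set_lebesgue_integral_def by (rule Bochner_Integration.integral_mult_left_zero)
      also have "\<dots> = H t" unfolding H_def CLBINT_Ioc_iexp[OF ab elim] ..
      finally show ?case ..
    qed
    show "(\<lambda>t. CLBINT x. K (t, x)) \<in> borel_measurable lborel"
      using KI by (intro borel_measurable_integrable lborel_pair.integrable_fst')
  qed simp
  also have "\<dots> = (CLBINT x. CLBINT t. K (t, x))"
    by (rule lborel_pair.Fubini_integral[symmetric]) (use KI in \<open>simp add: case_prod_beta'\<close>)
  also have "\<dots> = (CLBINT x. indicator {a<..b} x *\<^sub>R ft (char M) x)"
    unfolding ft_def by (auto intro!: Bochner_Integration.integral_cong simp: K_def indicator_def mult_ac)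
  finally have "Re (complex_of_real (measure M {a<..b})) = Re (1 / (2 * pi) * (CLBINT x. indicator {a<..b} x *\<^sub>R ft (char M) x))"
    unfolding L by simp
  moreover have "integrable lborel (\<lambda>x. indicator {a<..b} x *\<^sub>R ft (char M) x)"
    by (intro integrableI_bounded_set_indicator[where B="LBINT t. cmod (char M t)"])
       (use ab cmod_ft_le[OF \<phi>] in auto)
  then have "(LBINT x. Re (indicator {a<..b} x *\<^sub>R ft (char M) x)) = Re (CLBINT x. indicator {a<..b} x *\<^sub>R ft (char M) x)"
    by (rule integral_Re)
  ultimately have "measure M {a<..b} = (LBINT x. Re (indicator {a<..b} x *\<^sub>R ft (char M) x)) / (2 * pi)"
    by simp
  also have "\<dots> = (LBINT x:{a<..b}. Re (ft (char M) x) / (2 * pi))"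
    unfolding set_lebesgue_integral_def by simp
  finally show ?thesis .
qed

lemma real_distribution_prob_density:
  assumes "prob_density f"
  shows "real_distribution (density lborel (\<lambda>x. ennreal (f x)))"
proof -
  interpret prob_space "density lborel (\<lambda>x. ennreal (f x))"
    using assms by (intro prob_spaceI) (simp add: emeasure_density prob_density_def)
  show ?thesis by standard simp_all
qed

text \<open>A law with a density has no atoms, so the inversion formula is available on every interval.\<close>

lemma density_eq_inverse_ft:
  fixes f :: "real \<Rightarrow> real"
  assumes f: "prob_density f"
    and \<phi>: "integrable lborel (char (density lborel (\<lambda>x. ennreal (f x))))"
  shows "AE x in lborel. f x = Re (ft (char (density lborel (\<lambda>x. ennreal (f x)))) x) / (2 * pi)"
proof -
  define \<mu> where "\<mu> = density lborel (\<lambda>x. ennreal (f x))"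
  have fm [measurable]: "f \<in> borel_measurable borel" and f0: "\<And>x. 0 \<le> f x"
    and f1: "(\<integral>\<^sup>+x. ennreal (f x) \<partial>lborel) = 1"
    using f by (auto simp: prob_density_def)
  interpret \<mu>: real_distribution \<mu>
    unfolding \<mu>_def by (rule real_distribution_prob_density[OF f])
  have \<phi>': "integrable lborel (char \<mu>)" using \<phi> by (simp add: \<mu>_def)
  have fint: "integrable lborel f"
    by (rule integrableI_nonneg) (auto simp: f0 f1)
  have atom: "measure \<mu> {a} = 0" for a
  proof -
    have "emeasure \<mu> {a} = (\<integral>\<^sup>+x. ennreal (f x) * indicator {a} x \<partial>lborel)"
      unfolding \<mu>_def by (subst emeasure_density) auto
    also have "\<dots> = 0" 
    proof (subst nn_integral_0_iff_AE)
      show "AE x in lborel. ennreal (f x) * indicator {a} x = 0"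
        using AE_lborel_singleton[of a] by eventually_elim simp
    qed simp
    finally show ?thesis by (simp add: measure_def)
  qed
  have fset: "set_integrable lborel {a<..b} f" for a b
    unfolding set_integrable_def using integrable_mult_indicator[OF _ fint, of "{a<..b}"] by simp
  have mf: "measure \<mu> {a<..b} = (LBINT x:{a<..b}. f x)" for a b
  proof -
    have "emeasure \<mu> {a<..b} = (\<integral>\<^sup>+x. ennreal (indicator {a<..b} x *\<^sub>R f x) \<partial>lborel)"
      unfolding \<mu>_def by (subst emeasure_density) (auto intro!: nn_integral_cong simp: indicator_def)
    also have "\<dots> = ennreal (LBINT x:{a<..b}. f x)"
      using fset[of a b] f0 unfolding set_lebesgue_integral_def set_integrable_def
      by (simp add: nn_integral_eq_integral)
    finally show ?thesis
      using f0 by (simp add: measure_def set_lebesgue_integral_def)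
  qed
  have "AE x in lborel. f x = Re (ft (char \<mu>) x) / (2 * pi)"
  proof (rule AE_eq_if_Ioc_integrals_eq[OF fset])
    fix a b :: real assume ab: "a \<le> b"
    show "(LBINT x:{a<..b}. f x) = (LBINT x:{a<..b}. Re (ft (char \<mu>) x) / (2 * pi))"
      using \<mu>.Levy_inversion_integrable_char[OF ab atom atom \<phi>'] by (simp add: mf)
    show "set_integrable lborel {a<..b} (\<lambda>x. Re (ft (char \<mu>) x) / (2 * pi))"
      unfolding set_integrable_def
    proof (intro integrableI_bounded_set_indicator[where B="(LBINT t. cmod (char \<mu> t)) / (2 * pi)"])
      show "AE x\<in>{a<..b} in lborel. norm (Re (ft (char \<mu>) x) / (2 * pi)) \<le> (LBINT t. cmod (char \<mu> t)) / (2 * pi)"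
        using order_trans[OF abs_Re_le_cmod cmod_ft_le[OF \<phi>']] by (auto intro!: divide_right_mono)
    qed (use ab in auto)
  qed auto
  then show ?thesis unfolding \<mu>_def .
qed

section \<open>Exponentially weighted square integrability\<close>

text \<open>From \<open>y \<le> exp y\<close> at \<open>y = \<rho> \<alpha> \<bar>t\<bar> powr \<alpha> / 2\<close>, raised to the power \<open>2/\<alpha>\<close>, the reciprocal of the
  integrand is at least a positive multiple of \<open>t\<^sup>2\<close>; it is also at least 1, hence the integrand is dominated by a multiple of
  \<open>1 / (1 + t\<^sup>2)\<close>.\<close>

lemma integrable_exp_neg_powr:
  fixes \<rho> \<alpha> :: real
  assumes "0 < \<rho>" "0 < \<alpha>"
  shows "integrable lborel (\<lambda>t::real. exp (- (\<rho> * \<bar>t\<bar> powr \<alpha>)))"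
proof -
  define c where "c = (\<rho> * \<alpha> / 2) powr (2 / \<alpha>)"
  have c: "0 < c" using assms by (simp add: c_def)
  have le_exp: "y \<le> exp y" for y :: real using exp_ge_add_one_self[of y] by linarith
  have lower: "c * t\<^sup>2 \<le> exp (\<rho> * \<bar>t\<bar> powr \<alpha>)" for t :: real
  proof -
    have "c * t\<^sup>2 = (\<rho> * \<alpha> / 2 * \<bar>t\<bar> powr \<alpha>) powr (2 / \<alpha>)"
    proof -
      have "(\<bar>t\<bar> powr \<alpha>) powr (2 / \<alpha>) = t\<^sup>2"
        using assms by (cases "t = 0") (simp_all add: powr_powr)
      moreover have "(\<rho> * \<alpha> / 2 * \<bar>t\<bar> powr \<alpha>) powr (2 / \<alpha>) = c * (\<bar>t\<bar> powr \<alpha>) powr (2 / \<alpha>)"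
        unfolding c_def by (rule powr_mult)
      ultimately show ?thesis by simp
    qed
    also have "\<dots> \<le> exp (\<rho> * \<alpha> / 2 * \<bar>t\<bar> powr \<alpha>) powr (2 / \<alpha>)"
      using assms by (intro powr_mono2 le_exp) auto
    also have "\<dots> = exp (\<rho> * \<bar>t\<bar> powr \<alpha>)"
      using assms by (simp add: powr_def)
    finally show ?thesis .
  qed
  have "set_integrable lborel (einterval (- \<infinity>) \<infinity>) (\<lambda>x::real. inverse (1 + x\<^sup>2))"
    by (rule integrable_inverse_1_plus_square)
  then have I: "integrable lborel (\<lambda>t::real. (1 + 1 / c) * inverse (1 + t\<^sup>2))"
    by (simp add: set_integrable_def)
  show ?thesis
  proof (rule Bochner_Integration.integrable_bound[OF I])
    have "exp (- (\<rho> * \<bar>t\<bar> powr \<alpha>)) \<le> (1 + 1 / c) * inverse (1 + t\<^sup>2)" for t :: real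
    proof -
      have "1 + t\<^sup>2 \<le> exp (\<rho> * \<bar>t\<bar> powr \<alpha>) + exp (\<rho> * \<bar>t\<bar> powr \<alpha>) / c"
        using lower[of t] c assms by (intro add_mono) (simp_all add: field_simps)
      also have "\<dots> = (1 + 1 / c) * exp (\<rho> * \<bar>t\<bar> powr \<alpha>)" by (simp add: field_simps)
      finally have "(1 + t\<^sup>2) * exp (- (\<rho> * \<bar>t\<bar> powr \<alpha>)) \<le> 1 + 1 / c"
        by (simp add: exp_minus field_simps)
      moreover have "0 < 1 + t\<^sup>2" by (intro add_pos_nonneg) auto
      ultimately show ?thesis by (simp add: field_simps)
    qed
    moreover have "0 \<le> (1 + 1 / c) * inverse (1 + t\<^sup>2)" for t :: real using c by simp
    ultimately show "AE t in lborel. norm (exp (- (\<rho> * \<bar>t\<bar> powr \<alpha>))) \<le> norm ((1 + 1 / c) * inverse (1 + t\<^sup>2))"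
      by simp
  qed measurable
qed

text \<open>The arithmetic-geometric mean inequality for \<open>exp (y/2) * cmod (k t)\<close> and \<open>exp (- y/2)\<close>, with
  \<open>y = \<rho> \<bar>t\<bar> powr \<alpha>\<close>, dominates \<open>k\<close> by the sum of two integrable functions.\<close>

lemma integrable_of_weighted_sq:
  fixes k :: "real \<Rightarrow> complex" and \<rho> \<alpha> :: real
  assumes "0 < \<rho>" "0 < \<alpha>" and [measurable]: "k \<in> borel_measurable borel"
    and w: "integrable lborel (\<lambda>t. exp (\<rho> * \<bar>t\<bar> powr \<alpha>) * (cmod (k t))\<^sup>2)"
  shows "integrable lborel k"
proof (rule Bochner_Integration.integrable_bound)
  show "integrable lborel (\<lambda>t. exp (\<rho> * \<bar>t\<bar> powr \<alpha>) * (cmod (k t))\<^sup>2 + exp (- (\<rho> * \<bar>t\<bar> powr \<alpha>)))"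
    by (intro Bochner_Integration.integrable_add w integrable_exp_neg_powr assms)
  have "cmod (k t) \<le> exp y * (cmod (k t))\<^sup>2 + exp (- y)" for t y
  proof -
    have "2 * (exp (y / 2) * cmod (k t)) * exp (- y / 2) \<le> (exp (y / 2) * cmod (k t))\<^sup>2 + (exp (- y / 2))\<^sup>2"
      by (rule sum_squares_bound)
    also have "\<dots> = exp y * (cmod (k t))\<^sup>2 + exp (- y)"
      by (simp add: power_mult_distrib flip: exp_double)
    also have "2 * (exp (y / 2) * cmod (k t)) * exp (- y / 2) = 2 * cmod (k t)"
      by (simp add: exp_minus)
    finally show ?thesis using norm_ge_zero[of "k t"] by linarith
  qed
  then show "AE t in lborel. norm (k t) \<le> norm (exp (\<rho> * \<bar>t\<bar> powr \<alpha>) * (cmod (k t))\<^sup>2 + exp (- (\<rho> * \<bar>t\<bar> powr \<alpha>)))"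
    by (auto intro: order_trans[OF _ abs_ge_self])
qed simp

lemma tendsto_tail_integral:
  fixes w :: "real \<Rightarrow> real"
  assumes w: "integrable lborel w"
  shows "((\<lambda>T. LBINT t. indicator (- {- T<..T}) t * w t) \<longlongrightarrow> 0) at_top"
proof -
  have [measurable]: "w \<in> borel_measurable borel" using borel_measurable_integrable[OF w] by simp
  have "((\<lambda>T. LBINT t. indicator (- {- T<..T}) t * w t) \<longlongrightarrow> (LBINT t::real. (0::real))) at_top"
  proof (rule integral_dominated_convergence_at_top[where w = "\<lambda>t. \<bar>w t\<bar>"])
    show "AE t in lborel. ((\<lambda>T. indicator (- {- T<..T}) t * w t) \<longlongrightarrow> 0) at_top"
    proof (rule AE_I2)
      fix t :: real
      have "eventually (\<lambda>T. indicator (- {- T<..T}) t * w t = 0) at_top"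
        using eventually_gt_at_top[of "\<bar>t\<bar>"] by eventually_elim (auto simp: indicator_def)
      then show "((\<lambda>T. indicator (- {- T<..T}) t * w t) \<longlongrightarrow> 0) at_top" by (rule tendsto_eventually)
    qed
    show "\<forall>\<^sub>F T in at_top. AE t in lborel. norm (indicator (- {- T<..T}) t * w t) \<le> \<bar>w t\<bar>"
      by (intro always_eventually allI AE_I2) (auto simp: indicator_def)
  qed (use w in auto)
  then show ?thesis by simp
qed

section \<open>The sinc estimator in the frequency domain\<close>

definition emp_char :: "(nat \<Rightarrow> 'a \<Rightarrow> real) \<Rightarrow> nat \<Rightarrow> 'a \<Rightarrow> real \<Rightarrow> complex" where
  "emp_char X n \<omega> t = (\<Sum>j=1..n. iexp (t * X j \<omega>)) / of_nat n"

text \<open>The half-open band matches \<open>CLBINT_Ioc_iexp\<close>; the case \<open>u = 0\<close> reproduces the special value in the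
  definition of the estimator.\<close>

lemma CLBINT_band_iexp:
  assumes "0 < h"
  shows "(CLBINT t:{- (1 / h)<..1 / h}. iexp (- (t * u))) =
    complex_of_real (2 * (if u = 0 then 1 / h else sin (u / h) / u))"
proof (cases "u = 0")
  case True
  then show ?thesis
    using assms by (simp add: set_lebesgue_integral_def measure_def scaleR_conv_of_real)
next
  case False
  have "(CLBINT t:{- (1 / h)<..1 / h}. iexp (- (t * u))) = (CLBINT t:{- (1 / h)<..1 / h}. iexp (- (u * t)))"
    by (simp add: mult.commute)
  also have "\<dots> = (iexp (- (u * - (1 / h))) - iexp (- (u * (1 / h)))) / (\<i> * u)"
    using assms False by (intro CLBINT_Ioc_iexp) auto
  also have "\<dots> = complex_of_real (2 * (sin (u / h) / u))"
    using False by (simp add: complex_eq_iff Re_divide Im_divide Re_exp Im_exp field_simps power2_eq_square)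
  finally show ?thesis using False by simp
qed

lemma band_iexp_integrable:
  "integrable lborel (\<lambda>t. indicator {a<..b::real} t *\<^sub>R iexp (t * c))"
proof (cases "a \<le> b")
  case True
  then show ?thesis by (intro integrableI_bounded_set_indicator[where B = 1]) auto
qed simp

lemma band_emp_char_integrable:
  "integrable lborel (\<lambda>t. indicator {a<..b::real} t *\<^sub>R emp_char X n \<omega> t)"
proof -
  have "(\<lambda>t. indicator {a<..b::real} t *\<^sub>R emp_char X n \<omega> t) =
     (\<lambda>t. (\<Sum>j=1..n. indicator {a<..b} t *\<^sub>R iexp (t * X j \<omega>)) / of_nat n)"
    by (simp add: emp_char_def scaleR_sum_right scaleR_conv_of_real sum_distrib_left)
  then show ?thesis
    by (simp only:) (intro integrable_divide_zero Bochner_Integration.integrable_sum band_iexp_integrable impI)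
qed

lemma sinc_estimator_eq_ft:
  assumes h: "0 < h"
  shows "sinc_estimator X n h \<omega> x =
    Re (ft (\<lambda>t. indicator {- (1 / h)<..1 / h} t *\<^sub>R emp_char X n \<omega> t) x) / (2 * pi)"
proof -
  let ?B = "{- (1 / h)<..1 / h}"
  have "ft (\<lambda>t. indicator ?B t *\<^sub>R emp_char X n \<omega> t) x
    = (CLBINT t. (\<Sum>j=1..n. indicator ?B t *\<^sub>R iexp (- (t * (x - X j \<omega>)))) / of_nat n)"
    unfolding ft_def
  proof (rule Bochner_Integration.integral_cong[OF refl])
    fix t :: real
    have "iexp (t * X j \<omega>) * iexp (- (t * x)) = iexp (- (t * (x - X j \<omega>)))" for j
      by (simp add: right_diff_distrib flip: exp_add)
    then show "indicator ?B t *\<^sub>R emp_char X n \<omega> t * iexp (- (t * x)) =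
      (\<Sum>j=1..n. indicator ?B t *\<^sub>R iexp (- (t * (x - X j \<omega>)))) / of_nat n"
      unfolding emp_char_def scaleR_sum_right[symmetric] by (simp add: sum_distrib_right scaleR_conv_of_real)
  qed
  also have "\<dots> = (\<Sum>j=1..n. (CLBINT t. indicator ?B t *\<^sub>R iexp (- (t * (x - X j \<omega>))))) / of_nat n"
  proof -
    have "integrable lborel (\<lambda>t. indicator ?B t *\<^sub>R iexp (- (t * (x - X j \<omega>))))" for j
      using band_iexp_integrable[of "- (1 / h)" "1 / h" "- (x - X j \<omega>)"] by (simp only: mult_minus_right)
    then show ?thesis
      by (subst Bochner_Integration.integral_divide_zero, subst Bochner_Integration.integral_sum) auto
  qed
  also have "\<dots> = complex_of_real ((\<Sum>j=1..n. 2 * (if x - X j \<omega> = 0 then 1 / h else sin ((x - X j \<omega>) / h) / (x - X j \<omega>))) / real n)"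
    unfolding set_lebesgue_integral_def[symmetric] CLBINT_band_iexp[OF h] by simp
  finally show ?thesis
    unfolding sinc_estimator_def by (simp add: sum_distrib_left[symmetric] cong: if_cong)
qed

section \<open>Mean square error of the empirical characteristic function\<close>

lemma (in prob_space) expectation_sum_sq_indep:
  fixes Z :: "'i \<Rightarrow> 'a \<Rightarrow> real"
  assumes I: "finite I" and indep: "indep_vars (\<lambda>_. borel) Z I"
    and int: "\<And>i. i \<in> I \<Longrightarrow> integrable M (Z i)"
    and int2: "\<And>i. i \<in> I \<Longrightarrow> integrable M (\<lambda>\<omega>. (Z i \<omega>)\<^sup>2)"
    and mean: "\<And>i. i \<in> I \<Longrightarrow> expectation (Z i) = 0"
  shows "integrable M (\<lambda>\<omega>. (\<Sum>i\<in>I. Z i \<omega>)\<^sup>2)"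
    and "expectation (\<lambda>\<omega>. (\<Sum>i\<in>I. Z i \<omega>)\<^sup>2) = (\<Sum>i\<in>I. expectation (\<lambda>\<omega>. (Z i \<omega>)\<^sup>2))"
proof -
  have prod: "integrable M (\<lambda>\<omega>. Z i \<omega> * Z j \<omega>) \<and>
      expectation (\<lambda>\<omega>. Z i \<omega> * Z j \<omega>) = (if i = j then expectation (\<lambda>\<omega>. (Z i \<omega>)\<^sup>2) else 0)"
    if "i \<in> I" "j \<in> I" for i j
  proof (cases "i = j")
    case True
    then show ?thesis using int2[OF that(1)] by (simp add: power2_eq_square)
  next
    case False
    have "indep_vars (\<lambda>_. borel) Z {i, j}" using indep_vars_subset[OF indep] that by simp
    then show ?thesis
      using False indep_vars_lebesgue_integral[of "{i, j}" Z] indep_vars_integrable[of "{i, j}" Z] int mean that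
      by auto
  qed
  have sq: "(\<lambda>\<omega>. (\<Sum>i\<in>I. Z i \<omega>)\<^sup>2) = (\<lambda>\<omega>. \<Sum>i\<in>I. \<Sum>j\<in>I. Z i \<omega> * Z j \<omega>)"
    by (simp add: power2_eq_square sum_product)
  show "integrable M (\<lambda>\<omega>. (\<Sum>i\<in>I. Z i \<omega>)\<^sup>2)"
    unfolding sq using prod by (intro Bochner_Integration.integrable_sum) auto
  have "expectation (\<lambda>\<omega>. (\<Sum>i\<in>I. Z i \<omega>)\<^sup>2) = (\<Sum>i\<in>I. \<Sum>j\<in>I. expectation (\<lambda>\<omega>. Z i \<omega> * Z j \<omega>))"
    unfolding sq using prod by (simp add: Bochner_Integration.integral_sum)
  also have "\<dots> = (\<Sum>i\<in>I. \<Sum>j\<in>I. if i = j then expectation (\<lambda>\<omega>. (Z i \<omega>)\<^sup>2) else 0)"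
    using prod by (intro sum.cong) auto
  finally show "expectation (\<lambda>\<omega>. (\<Sum>i\<in>I. Z i \<omega>)\<^sup>2) = (\<Sum>i\<in>I. expectation (\<lambda>\<omega>. (Z i \<omega>)\<^sup>2))"
    using I by simp
qed

text \<open>The variance of a sum of independent variables is the sum of the variances, and each variance is at
  most the second moment. The second moments are kept on the right because those of cosine and sine
  add up to 1.\<close>

lemma (in prob_space) expectation_sum_centered_sq_le:
  fixes Y :: "'i \<Rightarrow> 'a \<Rightarrow> real"
  assumes I: "finite I" and indep: "indep_vars (\<lambda>_. borel) Y I"
    and bdd: "\<And>i \<omega>. i \<in> I \<Longrightarrow> \<bar>Y i \<omega>\<bar> \<le> 1"
  shows "integrable M (\<lambda>\<omega>. (\<Sum>i\<in>I. Y i \<omega> - expectation (Y i))\<^sup>2)"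
    and "expectation (\<lambda>\<omega>. (\<Sum>i\<in>I. Y i \<omega> - expectation (Y i))\<^sup>2) \<le> (\<Sum>i\<in>I. expectation (\<lambda>\<omega>. (Y i \<omega>)\<^sup>2))"
proof -
  have rv [measurable]: "random_variable borel (Y i)" if "i \<in> I" for i
    using indep that by (auto simp: indep_vars_def)
  have int: "integrable M (Y i)" if "i \<in> I" for i
    using bdd that by (intro integrable_const_bound[where B = 1]) (auto intro: rv)
  have int2: "integrable M (\<lambda>\<omega>. (Y i \<omega>)\<^sup>2)" if "i \<in> I" for i
    using bdd that by (intro integrable_const_bound[where B = 1]) (auto intro: rv simp: abs_square_le_1)
  have int2': "integrable M (\<lambda>\<omega>. (Y i \<omega> - expectation (Y i))\<^sup>2)" if "i \<in> I" for i
    unfolding power2_diff using int int2 that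
    by (intro Bochner_Integration.integrable_add Bochner_Integration.integrable_diff) auto
  have ind: "indep_vars (\<lambda>_. borel) (\<lambda>i \<omega>. Y i \<omega> - expectation (Y i)) I"
    by (rule indep_vars_compose2[OF indep, where Y="\<lambda>i y. y - expectation (Y i)"]) simp
  note S = expectation_sum_sq_indep[OF I ind]
  show "integrable M (\<lambda>\<omega>. (\<Sum>i\<in>I. Y i \<omega> - expectation (Y i))\<^sup>2)"
    using int int2' by (intro S) (auto simp: prob_space)
  have "expectation (\<lambda>\<omega>. (\<Sum>i\<in>I. Y i \<omega> - expectation (Y i))\<^sup>2) = (\<Sum>i\<in>I. variance (Y i))"
    using int int2' by (intro S) (auto simp: prob_space)
  also have "\<dots> \<le> (\<Sum>i\<in>I. expectation (\<lambda>\<omega>. (Y i \<omega>)\<^sup>2))"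
    using int int2 by (intro sum_mono) (simp add: variance_eq)
  finally show "expectation (\<lambda>\<omega>. (\<Sum>i\<in>I. Y i \<omega> - expectation (Y i))\<^sup>2) \<le> (\<Sum>i\<in>I. expectation (\<lambda>\<omega>. (Y i \<omega>)\<^sup>2))" .
qed

text \<open>The real and imaginary parts of \<open>n * (\<phi>\<^sub>n - \<phi>)\<close> are centred sums of the variables \<open>cos (t * X j)\<close> and
  \<open>sin (t * X j)\<close>. Their variances together are at most \<open>n\<close>, by \<open>cos\<^sup>2 + sin\<^sup>2 = 1\<close>.\<close>

lemma emp_char_mean_sq_error_le:
  assumes iid: "iid_sample M X n f" and n: "1 \<le> n"
  shows "(\<integral>\<^sup>+\<omega>. ennreal ((cmod (emp_char X n \<omega> t - char (density lborel (\<lambda>x. ennreal (f x))) t))\<^sup>2) \<partial>M)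
    \<le> ennreal (1 / n)"
proof -
  interpret prob_space M using iid by (simp add: iid_sample_def)
  let ?\<phi> = "char (density lborel (\<lambda>x. ennreal (f x))) t"
  let ?c = "\<lambda>j \<omega>. cos (t * X j \<omega>)" and ?s = "\<lambda>j \<omega>. sin (t * X j \<omega>)"
  have indep: "indep_vars (\<lambda>_. borel) X {1..n}" using iid by (simp add: iid_sample_def)
  have rv: "random_variable borel (X j)" if "j \<in> {1..n}" for j
    using indep that by (auto simp: indep_vars_def)
  have ci: "indep_vars (\<lambda>_. borel) ?c {1..n}" 
    by (rule indep_vars_compose2[OF indep, where Y="\<lambda>_ y. cos (t * y)"]) simp
  have si: "indep_vars (\<lambda>_. borel) ?s {1..n}" 
    by (rule indep_vars_compose2[OF indep, where Y="\<lambda>_ y. sin (t * y)"]) simp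
  have ie: "complex_integrable M (\<lambda>\<omega>. iexp (t * X j \<omega>))" if "j \<in> {1..n}" for j
    using rv[OF that] by (intro integrable_const_bound[where B = 1]) auto
  have Ec: "expectation (?c j) = Re ?\<phi>" and Es: "expectation (?s j) = Im ?\<phi>" if "j \<in> {1..n}" for j
    unfolding char_density_iid_sample[OF iid that]
    by (subst integral_Re[symmetric, OF ie[OF that]], simp add: Re_exp)
       (subst integral_Im[symmetric, OF ie[OF that]], simp add: Im_exp)
  define S where "S \<omega> = (\<Sum>j=1..n. ?c j \<omega> - expectation (?c j))\<^sup>2 + (\<Sum>j=1..n. ?s j \<omega> - expectation (?s j))\<^sup>2" for \<omega>
  have sq: "(cmod (emp_char X n \<omega> t - ?\<phi>))\<^sup>2 = S \<omega> / (real n)\<^sup>2" for \<omega>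
  proof -
    have "emp_char X n \<omega> t - ?\<phi> = (\<Sum>j=1..n. iexp (t * X j \<omega>) - ?\<phi>) / of_nat n"
      using n by (simp add: emp_char_def sum_subtractf field_simps)
    then have "(cmod (emp_char X n \<omega> t - ?\<phi>))\<^sup>2 = (cmod (\<Sum>j=1..n. iexp (t * X j \<omega>) - ?\<phi>))\<^sup>2 / (real n)\<^sup>2"
      by (simp add: norm_divide power_divide)
    also have "(cmod (\<Sum>j=1..n. iexp (t * X j \<omega>) - ?\<phi>))\<^sup>2 = S \<omega>"
      unfolding cmod_power2 S_def by (simp add: Re_exp Im_exp Ec Es)
    finally show ?thesis .
  qed
  have S0: "0 \<le> S \<omega>" for \<omega> unfolding S_def by simp
  note C = expectation_sum_centered_sq_le[OF _ ci] and D = expectation_sum_centered_sq_le[OF _ si]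
  have SI: "integrable M S" unfolding S_def using C(1) D(1) by auto
  have "expectation S \<le> (\<Sum>j=1..n. expectation (\<lambda>\<omega>. (?c j \<omega>)\<^sup>2)) + (\<Sum>j=1..n. expectation (\<lambda>\<omega>. (?s j \<omega>)\<^sup>2))"
    unfolding S_def using C D by (subst Bochner_Integration.integral_add) (auto intro!: add_mono)
  also have "\<dots> = (\<Sum>j=1..n. expectation (\<lambda>\<omega>. (?c j \<omega>)\<^sup>2 + (?s j \<omega>)\<^sup>2))"
    unfolding sum.distrib[symmetric]
  proof (intro sum.cong refl Bochner_Integration.integral_add[symmetric])
    fix j assume "j \<in> {1..n}"
    note [measurable] = rv[OF this]
    show "integrable M (\<lambda>\<omega>. (?c j \<omega>)\<^sup>2)" "integrable M (\<lambda>\<omega>. (?s j \<omega>)\<^sup>2)"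
      by (intro integrable_const_bound[where B = 1]; simp add: abs_square_le_1)+
  qed
  also have "\<dots> = real n" by (simp add: prob_space)
  finally have "expectation S / (real n)\<^sup>2 \<le> real n / (real n)\<^sup>2" by (intro divide_right_mono) auto
  also have "\<dots> = 1 / real n" by (simp add: power2_eq_square)
  finally have le: "expectation S / (real n)\<^sup>2 \<le> 1 / real n" .
  have "(\<integral>\<^sup>+\<omega>. ennreal ((cmod (emp_char X n \<omega> t - ?\<phi>))\<^sup>2) \<partial>M) = ennreal (expectation S / (real n)\<^sup>2)"
    unfolding sq using SI S0 by (subst nn_integral_eq_integral) auto
  then show ?thesis using le by (simp add: ennreal_leI)
qed

section \<open>The mean integrated square error\<close>

text \<open>This holds for every single outcome \<open>\<omega>\<close>. By linearity the error is the real part of \<open>ft (d) / (2\<pi>)\<close>,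
  where \<open>d\<close> is the band-limited \<open>\<phi>\<^sub>n\<close> minus \<open>\<phi>\<close>, and Plancherel's inequality gives
  \<open>(2\<pi>) / (2\<pi>)\<^sup>2 = 1/(2\<pi>)\<close>.\<close>

lemma integrated_sq_error_le:
  assumes f: "prob_density f" and \<phi>_def: "\<phi> = char (density lborel (\<lambda>x. ennreal (f x)))"
    and \<phi>: "integrable lborel \<phi>" and h: "0 < h"
  shows "(\<integral>\<^sup>+x. ennreal ((sinc_estimator X n h \<omega> x - f x)\<^sup>2) \<partial>lborel)
    \<le> ennreal (1 / (2 * pi)) *
      (\<integral>\<^sup>+t. ennreal ((cmod (indicator {- (1 / h)<..1 / h} t *\<^sub>R emp_char X n \<omega> t - \<phi> t))\<^sup>2) \<partial>lborel)"
proof -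
  let ?e = "\<lambda>t. indicator {- (1 / h)<..1 / h} t *\<^sub>R emp_char X n \<omega> t"
  have ei: "integrable lborel ?e" by (rule band_emp_char_integrable)
  then have di: "integrable lborel (\<lambda>t. ?e t - \<phi> t)" using \<phi> by simp
  have [measurable]: "(\<lambda>t. ?e t - \<phi> t) \<in> borel_measurable borel"
    using borel_measurable_integrable[OF di] by simp
  have ft_diff: "ft (\<lambda>t. ?e t - \<phi> t) x = ft ?e x - ft \<phi> x" for x
    unfolding ft_def left_diff_distrib
    by (intro Bochner_Integration.integral_diff integrable_times_iexp ei \<phi>)
  have "(\<integral>\<^sup>+x. ennreal ((sinc_estimator X n h \<omega> x - f x)\<^sup>2) \<partial>lborel)
    \<le> (\<integral>\<^sup>+x. ennreal (1 / (2 * pi)\<^sup>2) * ennreal ((cmod (ft (\<lambda>t. ?e t - \<phi> t) x))\<^sup>2) \<partial>lborel)"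
  proof (rule nn_integral_mono_AE)
    show "AE x in lborel. ennreal ((sinc_estimator X n h \<omega> x - f x)\<^sup>2)
      \<le> ennreal (1 / (2 * pi)\<^sup>2) * ennreal ((cmod (ft (\<lambda>t. ?e t - \<phi> t) x))\<^sup>2)"
      using density_eq_inverse_ft[OF f \<phi>[unfolded \<phi>_def], folded \<phi>_def]
    proof eventually_elim
      case (elim x)
      have "sinc_estimator X n h \<omega> x - f x = Re (ft (\<lambda>t. ?e t - \<phi> t) x) / (2 * pi)"
        unfolding sinc_estimator_eq_ft[OF h] elim ft_diff by (simp add: diff_divide_distrib)
      then have "(sinc_estimator X n h \<omega> x - f x)\<^sup>2 = (Re (ft (\<lambda>t. ?e t - \<phi> t) x))\<^sup>2 / (2 * pi)\<^sup>2"
        by (simp only: power_divide)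
      also have "\<dots> \<le> (cmod (ft (\<lambda>t. ?e t - \<phi> t) x))\<^sup>2 / (2 * pi)\<^sup>2"
        by (intro divide_right_mono) (auto simp: cmod_power2)
      finally show ?case by (simp add: ennreal_leI flip: ennreal_mult)
    qed
  qed
  also have "\<dots> = ennreal (1 / (2 * pi)\<^sup>2) * (\<integral>\<^sup>+x. ennreal ((cmod (ft (\<lambda>t. ?e t - \<phi> t) x))\<^sup>2) \<partial>lborel)"
    by (rule nn_integral_cmult) simp
  also have "\<dots> \<le> ennreal (1 / (2 * pi)\<^sup>2) * (ennreal (2 * pi) * (\<integral>\<^sup>+t. ennreal ((cmod (?e t - \<phi> t))\<^sup>2) \<partial>lborel))"
    by (intro mult_left_mono plancherel_le[OF di]) simp
  also have "\<dots> = ennreal (1 / (2 * pi)\<^sup>2 * (2 * pi)) * (\<integral>\<^sup>+t. ennreal ((cmod (?e t - \<phi> t))\<^sup>2) \<partial>lborel)"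
    by (subst ennreal_mult) (simp_all only: mult.assoc, simp_all)
  also have "1 / (2 * pi)\<^sup>2 * (2 * pi) = 1 / (2 * pi)" by (simp add: power2_eq_square)
  finally show ?thesis .
qed

text \<open>The split into variance and squared bias. Tonelli's theorem puts the expectation inside the frequency
  integral, where the integrand is random only in the band.\<close>

lemma MISE_sinc_le:
  assumes f: "prob_density f" and \<phi>_def: "\<phi> = char (density lborel (\<lambda>x. ennreal (f x)))"
    and \<phi>: "integrable lborel \<phi>" and h: "0 < h" and n: "1 \<le> n" and iid: "iid_sample M X n f"
  shows "MISE M (sinc_estimator X n h) f
    \<le> ennreal (1 / (2 * pi)) *
      (ennreal (2 / (n * h)) + (\<integral>\<^sup>+t. ennreal (indicator (- {- (1 / h)<..1 / h}) t * (cmod (\<phi> t))\<^sup>2) \<partial>lborel))"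
proof -
  interpret prob_space M using iid by (simp add: iid_sample_def)
  interpret P: pair_sigma_finite lborel M ..
  let ?B = "{- (1 / h)<..1 / h}"
  define d where "d \<omega> t = indicator ?B t *\<^sub>R emp_char X n \<omega> t - \<phi> t" for \<omega> t
  have rv: "X j \<in> borel_measurable M" if "j \<in> {1..n}" for j
    using iid that unfolding iid_sample_def indep_vars_def by auto
  have [measurable]: "\<phi> \<in> borel_measurable borel" using borel_measurable_integrable[OF \<phi>] by simp
  have em: "(\<lambda>p. emp_char X n (snd p) (fst p)) \<in> borel_measurable (lborel \<Otimes>\<^sub>M M)"
    unfolding emp_char_def
  proof (intro borel_measurable_divide borel_measurable_sum borel_measurable_const)
    fix j assume "j \<in> {1..n}"
    note [measurable] = rv[OF this]
    show "(\<lambda>p. iexp (fst p * X j (snd p))) \<in> borel_measurable (lborel \<Otimes>\<^sub>M M)" by measurable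
  qed
  have [measurable]: "(\<lambda>p. d (snd p) (fst p)) \<in> borel_measurable (lborel \<Otimes>\<^sub>M M)"
    unfolding d_def by (intro borel_measurable_diff borel_measurable_scaleR em) measurable
  have dm: "(\<lambda>(\<omega>, t). ennreal ((cmod (d \<omega> t))\<^sup>2)) \<in> borel_measurable (M \<Otimes>\<^sub>M lborel)"
  proof -
    have "(\<lambda>p. ennreal ((cmod (d (snd p) (fst p)))\<^sup>2)) \<in> borel_measurable (lborel \<Otimes>\<^sub>M M)" by measurable
    from measurable_pair_swap[OF this] show ?thesis by (simp add: case_prod_beta')
  qed
  have "MISE M (sinc_estimator X n h) f
    \<le> (\<integral>\<^sup>+\<omega>. ennreal (1 / (2 * pi)) * (\<integral>\<^sup>+t. ennreal ((cmod (d \<omega> t))\<^sup>2) \<partial>lborel) \<partial>M)"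
    unfolding MISE_def d_def by (intro nn_integral_mono integrated_sq_error_le[OF f \<phi>_def \<phi> h])
  also have "\<dots> = ennreal (1 / (2 * pi)) * (\<integral>\<^sup>+\<omega>. (\<integral>\<^sup>+t. ennreal ((cmod (d \<omega> t))\<^sup>2) \<partial>lborel) \<partial>M)"
    by (intro nn_integral_cmult lborel.borel_measurable_nn_integral dm)
  also have "(\<integral>\<^sup>+\<omega>. (\<integral>\<^sup>+t. ennreal ((cmod (d \<omega> t))\<^sup>2) \<partial>lborel) \<partial>M)
      = (\<integral>\<^sup>+t. (\<integral>\<^sup>+\<omega>. ennreal ((cmod (d \<omega> t))\<^sup>2) \<partial>M) \<partial>lborel)"
    by (rule P.Fubini') (simp add: case_prod_beta')
  also have "\<dots> \<le> (\<integral>\<^sup>+t. ennreal (1 / n) * indicator ?B t + ennreal (indicator (- ?B) t * (cmod (\<phi> t))\<^sup>2) \<partial>lborel)"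
  proof (rule nn_integral_mono)
    fix t :: real
    show "(\<integral>\<^sup>+\<omega>. ennreal ((cmod (d \<omega> t))\<^sup>2) \<partial>M)
      \<le> ennreal (1 / n) * indicator ?B t + ennreal (indicator (- ?B) t * (cmod (\<phi> t))\<^sup>2)"
    proof (cases "t \<in> ?B")
      case True
      have "(\<integral>\<^sup>+\<omega>. ennreal ((cmod (d \<omega> t))\<^sup>2) \<partial>M) \<le> ennreal (1 / n)"
        using emp_char_mean_sq_error_le[OF iid n, of t] True unfolding d_def \<phi>_def by simp
      then show ?thesis using True by simp
    next
      case False
      then show ?thesis unfolding d_def by (simp add: emeasure_space_1)
    qed
  qed
  also have "\<dots> = (\<integral>\<^sup>+t. ennreal (1 / n) * indicator ?B t \<partial>lborel)
      + (\<integral>\<^sup>+t. ennreal (indicator (- ?B) t * (cmod (\<phi> t))\<^sup>2) \<partial>lborel)"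
    by (rule nn_integral_add) auto
  also have "(\<integral>\<^sup>+t. ennreal (1 / n) * indicator ?B t \<partial>lborel) = ennreal (1 / n) * ennreal (1 / h - - (1 / h))"
    using h by (subst nn_integral_cmult_indicator) auto
  also have "\<dots> = ennreal (2 / (n * h))"
    using h by (simp flip: ennreal_mult)
  finally show ?thesis by (simp add: mult_left_mono)
qed

theorem theorem8p3:
  fixes f :: "real \<Rightarrow> real" and \<phi> :: "real \<Rightarrow> complex" and \<rho> \<alpha> C :: real
  assumes "prob_density f"
    and "\<phi> = char (density lborel (\<lambda>x. ennreal (f x)))"
    and "\<rho> > 0" and "0 < \<alpha>" and "\<alpha> \<le> 2"
    and "integrable lborel (\<lambda>t. exp (\<rho> * \<bar>t\<bar> powr \<alpha>) * (cmod (\<phi> t))\<^sup>2)"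
    and "1 / (2 * pi) * (LBINT t. exp (\<rho> * \<bar>t\<bar> powr \<alpha>) * (cmod (\<phi> t))\<^sup>2) = C"
  shows "\<exists>\<epsilon> :: real \<Rightarrow> real.
           (\<forall>h>0. 0 < \<epsilon> h \<and> \<epsilon> h < 1) \<and>
           (\<epsilon> \<longlongrightarrow> 0) (at_right 0) \<and>
           (\<forall>n\<ge>1. \<forall>h>0. \<forall>(M :: 'a measure) X. iid_sample M X n f \<longrightarrow>
              MISE M (sinc_estimator X n h) f
                \<le> ennreal (\<epsilon> h * C * exp (- \<rho> / h powr \<alpha>) + 1 / (pi * real n * h)))"
proof -
  note f = assms(1) and \<phi>_def = assms(2) and \<rho> = assms(3) and \<alpha> = assms(4)
  define w where "w t = exp (\<rho> * \<bar>t\<bar> powr \<alpha>) * (cmod (\<phi> t))\<^sup>2" for t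
  have wi: "integrable lborel w" using assms(6) unfolding w_def .
  have w0: "0 \<le> w t" for t by (simp add: w_def)
  interpret \<mu>: real_distribution "density lborel (\<lambda>x. ennreal (f x))"
    by (rule real_distribution_prob_density[OF f])
  have \<phi>m [measurable]: "\<phi> \<in> borel_measurable borel" unfolding \<phi>_def by measurable
  have \<phi>: "integrable lborel \<phi>"
    using integrable_of_weighted_sq[OF \<rho> \<alpha> \<phi>m] assms(6) by simp
  define B :: "real \<Rightarrow> real set" where "B h = {- (1 / h)<..1 / h}" for h
  define tail where "tail h = (LBINT t. indicator (- B h) t * w t)" for h
  have [measurable]: "B h \<in> sets borel" for h unfolding B_def by simp
  have ti: "integrable lborel (\<lambda>t. indicator A t * w t)" if "A \<in> sets borel" for A
    using integrable_mult_indicator[OF _ wi, of A] that by simp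
  have tail0: "0 \<le> tail h" for h
    unfolding tail_def using w0 by (intro integral_nonneg_AE) simp
  \<comment> \<open>The band carries weight, as \<open>\<phi>\<close> stays above \<open>1/2\<close> near the origin. This makes both \<open>C\<close> positive and the tail fraction less than 1.\<close>
  have core: "0 < (LBINT t. indicator (B h) t * w t)" if h: "0 < h" for h
  proof -
    have "\<phi> 0 = 1" unfolding \<phi>_def by (rule \<mu>.char_zero)
    moreover have "isCont \<phi> 0" unfolding \<phi>_def by (rule \<mu>.isCont_char)
    then have "((\<lambda>t. cmod (\<phi> t)) \<longlongrightarrow> cmod (\<phi> 0)) (at 0)"
      unfolding isCont_def by (rule tendsto_norm)
    ultimately have "eventually (\<lambda>t. 1 / 2 < cmod (\<phi> t)) (at 0)"
      by (intro order_tendstoD(1)) auto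
    then obtain \<delta> where \<delta>: "0 < \<delta>" "\<And>t. t \<noteq> 0 \<Longrightarrow> \<bar>t\<bar> < \<delta> \<Longrightarrow> 1 / 2 < cmod (\<phi> t)"
      unfolding eventually_at by (auto simp: dist_real_def)
    \<comment> \<open>Small enough for \<open>{0<..c}\<close> to lie in the band and in the neighbourhood where \<open>\<bar>\<phi>\<bar> > 1/2\<close>.\<close>
  define c where "c = min (\<delta> / 2) (1 / h)"
    have c: "0 < c" "c < \<delta>" "c \<le> 1 / h" using \<delta>(1) h by (auto simp: c_def)
    have "0 < c / 4" using c by simp
    also have "c / 4 = (LBINT t. indicator {0<..c} t * (1 / 4))"
      using c by simp
    also have "\<dots> \<le> (LBINT t. indicator (B h) t * w t)"
    proof (rule integral_mono)
      show "integrable lborel (\<lambda>t. indicator {0<..c} t * (1 / 4 :: real))" using c by simp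
      fix t :: real
      show "indicator {0<..c} t * (1 / 4) \<le> indicator (B h) t * w t"
      proof (cases "t \<in> {0<..c}")
        case True
        then have "t \<in> B h" using c h by (auto simp: B_def intro: less_trans[of _ 0])
        have "(1 / 2)\<^sup>2 \<le> (cmod (\<phi> t))\<^sup>2" using \<delta>(2)[of t] True c by (intro power_mono) auto
        also have "\<dots> \<le> w t" using \<rho> by (simp add: w_def mult_le_cancel_right1)
        finally show ?thesis using True \<open>t \<in> B h\<close> by (simp add: power2_eq_square)
      qed (simp add: w0)
    qed (simp add: ti)
    finally show ?thesis .
  qed
  have split: "(LBINT t. indicator (B h) t * w t) + tail h = 2 * pi * C" for h
  proof -
    have "(LBINT t. indicator (B h) t * w t) + tail h = (LBINT t. indicator (B h) t * w t + indicator (- B h) t * w t)"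
      unfolding tail_def by (intro Bochner_Integration.integral_add[symmetric] ti) auto
    also have "\<dots> = (LBINT t. w t)"
      by (intro Bochner_Integration.integral_cong) (auto simp: indicator_def)
    finally show ?thesis using assms(7) by (simp add: w_def field_simps)
  qed
  define r where "r h = tail h / (2 * pi * C)" for h
  have C: "0 < C"
  proof -
    have "0 < 2 * pi * C" using core[of 1] tail0[of 1] split[of 1] by linarith
    then show ?thesis by (simp add: zero_less_mult_iff)
  qed
  have r: "0 \<le> r h" for h using tail0 C by (simp add: r_def)
  have r1: "r h < 1" if "0 < h" for h
    using core[OF that] split[of h] C by (simp add: r_def)
  \<comment> \<open>The convex combination of \<open>r h\<close> and 1 with weights \<open>1 / (1 + h)\<close> and \<open>h / (1 + h)\<close>: it lies above \<open>r h\<close>, is positive even if \<open>r h = 0\<close>, and stays below 1.\<close>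
  define \<epsilon> where "\<epsilon> h = (r h + h) / (1 + h)" for h
  have \<epsilon>: "0 < \<epsilon> h" "\<epsilon> h < 1" "r h \<le> \<epsilon> h" if h: "0 < h" for h
  proof -
    show "0 < \<epsilon> h" using r[of h] h by (simp add: \<epsilon>_def add_nonneg_pos)
    show "\<epsilon> h < 1" using r1[OF h] h by (simp add: \<epsilon>_def)
    have "r h * h \<le> 1 * h" using r1[OF h] h by (intro mult_right_mono) auto
    then show "r h \<le> \<epsilon> h" using h by (simp add: \<epsilon>_def field_simps)
  qed
  have "((\<lambda>h. tail h) \<longlongrightarrow> 0) (at_right 0)"
    using filterlim_compose[OF tendsto_tail_integral[OF wi] filterlim_inverse_at_top_right]
    by (simp add: tail_def B_def inverse_eq_divide)
  then have "(\<epsilon> \<longlongrightarrow> (0 / (2 * pi * C) + 0) / (1 + 0)) (at_right 0)"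
    unfolding \<epsilon>_def[abs_def] r_def using C by (intro tendsto_intros) auto
  then have lim: "(\<epsilon> \<longlongrightarrow> 0) (at_right 0)" by simp
  have bound: "MISE M (sinc_estimator X n h) f
      \<le> ennreal (\<epsilon> h * C * exp (- \<rho> / h powr \<alpha>) + 1 / (pi * real n * h))"
    if n: "1 \<le> n" and h: "0 < h" and iid: "iid_sample M X n f" for n h and M :: "'a measure" and X
  proof -
    define E where "E = exp (- \<rho> / h powr \<alpha>)"
    have E: "0 < E" by (simp add: E_def)
    \<comment> \<open>Outside the band the exponential weight in \<open>w\<close> is at least \<open>1 / E\<close>.\<close>
    have decay: "indicator (- B h) t * (cmod (\<phi> t))\<^sup>2 \<le> E * (indicator (- B h) t * w t)" for t
    proof (cases "t \<in> B h")
      case False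
      then have "1 / h \<le> \<bar>t\<bar>" by (auto simp: B_def)
      then have "(1 / h) powr \<alpha> \<le> \<bar>t\<bar> powr \<alpha>" using h \<alpha> by (intro powr_mono2) auto
      then have "\<rho> * (1 / h) powr \<alpha> \<le> \<rho> * \<bar>t\<bar> powr \<alpha>" using \<rho> by simp
      then have "1 \<le> E * exp (\<rho> * \<bar>t\<bar> powr \<alpha>)"
        using h by (simp add: E_def powr_divide flip: exp_add)
      then have "1 * (cmod (\<phi> t))\<^sup>2 \<le> (E * exp (\<rho> * \<bar>t\<bar> powr \<alpha>)) * (cmod (\<phi> t))\<^sup>2"
        by (rule mult_right_mono) simp
      then show ?thesis using False by (simp add: w_def mult.assoc)
    qed simp
    have "(\<integral>\<^sup>+t. ennreal (indicator (- B h) t * (cmod (\<phi> t))\<^sup>2) \<partial>lborel)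
      \<le> (\<integral>\<^sup>+t. ennreal (E * (indicator (- B h) t * w t)) \<partial>lborel)"
      by (intro nn_integral_mono ennreal_leI decay)
    also have "\<dots> = ennreal (E * tail h)"
      unfolding tail_def using E w0 ti[of "- B h"]
      by (subst nn_integral_eq_integral) (auto simp: indicator_def)
    finally have T: "(\<integral>\<^sup>+t. ennreal (indicator (- B h) t * (cmod (\<phi> t))\<^sup>2) \<partial>lborel) \<le> ennreal (E * tail h)" .
    have "MISE M (sinc_estimator X n h) f \<le> ennreal (1 / (2 * pi)) *
        (ennreal (2 / (n * h)) + (\<integral>\<^sup>+t. ennreal (indicator (- B h) t * (cmod (\<phi> t))\<^sup>2) \<partial>lborel))"
      unfolding B_def by (rule MISE_sinc_le[OF f \<phi>_def \<phi> h n iid])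
    also have "\<dots> \<le> ennreal (1 / (2 * pi)) * (ennreal (2 / (n * h)) + ennreal (E * tail h))"
      by (intro mult_left_mono add_left_mono T) simp
    also have "\<dots> = ennreal (1 / (2 * pi) * (2 / (n * h) + E * tail h))"
      using h E tail0[of h] by (simp flip: ennreal_plus ennreal_mult)
    also have "1 / (2 * pi) * (2 / (n * h) + E * tail h) = r h * C * E + 1 / (pi * n * h)"
      using C by (simp add: r_def field_simps)
    also have "ennreal \<dots> \<le> ennreal (\<epsilon> h * C * E + 1 / (pi * n * h))"
      using \<epsilon>(3)[OF h] C E by (intro ennreal_leI add_right_mono mult_right_mono) auto
    finally show ?thesis unfolding E_def .
  qed
  show ?thesis
    using \<epsilon>(1,2) lim bound by (intro exI[of _ \<epsilon>]) blast
qed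

end
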